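(* Let $R$ be a commutative ring and let $M$ be a nonzero quasi-primeful $R$-module. (1) Let $I$ be a radical ideal of $R$. Then $(IM:M)=I$ if and only if $\mathrm{Ann}(M)\subseteq I$. (2) $\mathfrak p M\in q\mathrm{Spec}(M)$ for every prime ideal $\mathfrak p$ of $R$ containing $\mathrm{Ann}(M)$. (3) $\mathfrak p M$ is a $\mathfrak p$-prime submodule of $M$ for every maximal ideal $\mathfrak p$ of $R$ containing $\mathrm{Ann}(M)$. (4) If $\dim(R)=0$, then $M$ is primeful. (5) If $M$ is a multiplication module, then $M$ is finitely generated.
   Context: All rings are commutative with nonzero identity and all modules are unital. For a submodule $N$ of an $R$-module $M$, $(N:M)=\{r\in R\mid rM\subseteq N\}$ and $\mathrm{Ann}(M)=(\mathbf{0}:M)$. A proper ideal $I$ of a ring is quasi-prime if for all ideals $A,B$, $A\cap B\subseteq I$ implies $A\subseteq I$ or $B\subseteq I$. A proper submodule $N$ of $M$ is quasi-prime if $(N:M)$ is a quasi-prime ideal of $R$; $q\mathrm{Spec}(M)$ is the set of all quasi-prime submodules of $M$. The natural map is $\psi: q\mathrm{Spec}(M)\to q\mathrm{Spec}(R/\mathrm{Ann}(M))$, $\psi(L)=(L:M)/\mathrm{Ann}(M)$, where $q\mathrm{Spec}(R/\mathrm{Ann}(M))$ is the set of quasi-prime ideals of $R/\mathrm{Ann}(M)$. A nonzero module $M$ is quasi-primeful if its natural map is surjective (the zero module is also called quasi-primeful). A submodule $P\ne M$ is prime if $rm\in P$ ($r\in R$, $m\in M$) implies $r\in(P:M)$ or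 $m\in P$; it is then $\mathfrak p$-prime with $\mathfrak p=(P:M)$. $\mathrm{Spec}(M)$ is the set of prime submodules of $M$. $M$ is primeful if $M=(\mathbf 0)$, or $M\neq(\mathbf 0)$ and the map $\mathrm{Spec}(M)\to\mathrm{Spec}(R/\mathrm{Ann}(M))$, $P\mapsto (P:M)/\mathrm{Ann}(M)$, is surjective. $M$ is a multiplication module if every submodule of $M$ has the form $IM$ for some ideal $I$ of $R$. *)

theory Defs
  imports "HOL-Library.Extended_Nat" "HOL-Algebra.QuotRing" "HOL-Algebra.Module"
begin

definition quasi_prime_ideal :: "'a set \<Rightarrow> ('a, 'm) ring_scheme \<Rightarrow> bool" where
  "quasi_prime_ideal I R \<longleftrightarrow> ideal I R \<and> I \<noteq> carrier R \<and>
     (\<forall>A B. ideal A R \<longrightarrow> ideal B R \<longrightarrow> A \<inter> B \<subseteq> I \<longrightarrow> A \<subseteq> I \<or> B \<subseteq> I)"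

definition rad :: "('a, 'm) ring_scheme \<Rightarrow> 'a set \<Rightarrow> 'a set" where
  "rad R I = {r \<in> carrier R. \<exists>n::nat. n > 0 \<and> r [^]\<^bsub>R\<^esub> n \<in> I}"

text \<open>A radical ideal need not be proper: the unit ideal is radical.\<close>

definition radical_ideal :: "'a set \<Rightarrow> ('a, 'm) ring_scheme \<Rightarrow> bool" where
  "radical_ideal I R \<longleftrightarrow> ideal I R \<and> rad R I = I"

text \<open>Krull dimension: the supremum of the lengths \<open>n\<close> of chains
  \<open>P 0 \<subset> P 1 \<subset> \<dots> \<subset> P n\<close> of prime ideals. The supremum of the empty set of
  chains is \<open>0\<close> in \<^typ>\<open>enat\<close>, so the value is meaningful for nonzero rings only.\<close>

definition krull_dim :: "('a, 'm) ring_scheme \<Rightarrow> enat" where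
  "krull_dim R = Sup {enat n | n. \<exists>P :: nat \<Rightarrow> 'a set.
     (\<forall>i\<le>n. primeideal (P i) R) \<and> (\<forall>i<n. P i \<subset> P (Suc i))}"

definition submodule_gen ::
    "('a, 'm) ring_scheme \<Rightarrow> ('a, 'b, 'n) module_scheme \<Rightarrow> 'b set \<Rightarrow> 'b set" where
  "submodule_gen R M S = \<Inter>{N. submodule N R M \<and> S \<subseteq> N}"

definition fin_gen_module ::
    "('a, 'm) ring_scheme \<Rightarrow> ('a, 'b, 'n) module_scheme \<Rightarrow> bool" where
  "fin_gen_module R M \<longleftrightarrow>
     (\<exists>S. finite S \<and> S \<subseteq> carrier M \<and> submodule_gen R M S = carrier M)"

definition ideal_smult ::
    "('a, 'm) ring_scheme \<Rightarrow> ('a, 'b, 'n) module_scheme \<Rightarrow> 'a set \<Rightarrow> 'b set" where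
  "ideal_smult R M I = submodule_gen R M {a \<odot>\<^bsub>M\<^esub> x | a x. a \<in> I \<and> x \<in> carrier M}"

definition colon ::
    "('a, 'm) ring_scheme \<Rightarrow> ('a, 'b, 'n) module_scheme \<Rightarrow> 'b set \<Rightarrow> 'a set" where
  "colon R M N = {r \<in> carrier R. \<forall>x\<in>carrier M. r \<odot>\<^bsub>M\<^esub> x \<in> N}"

definition annihilator ::
    "('a, 'm) ring_scheme \<Rightarrow> ('a, 'b, 'n) module_scheme \<Rightarrow> 'a set" where
  "annihilator R M = colon R M {\<zero>\<^bsub>M\<^esub>}"

definition multiplication_module ::
    "('a, 'm) ring_scheme \<Rightarrow> ('a, 'b, 'n) module_scheme \<Rightarrow> bool" where
  "multiplication_module R M \<longleftrightarrow>
     (\<forall>N. submodule N R M \<longrightarrow> (\<exists>I. ideal I R \<and> N = ideal_smult R M I))"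

definition quasi_prime_submodule ::
    "'b set \<Rightarrow> ('a, 'm) ring_scheme \<Rightarrow> ('a, 'b, 'n) module_scheme \<Rightarrow> bool" where
  "quasi_prime_submodule N R M \<longleftrightarrow>
     submodule N R M \<and> N \<noteq> carrier M \<and> quasi_prime_ideal (colon R M N) R"

definition prime_submodule ::
    "'b set \<Rightarrow> ('a, 'm) ring_scheme \<Rightarrow> ('a, 'b, 'n) module_scheme \<Rightarrow> bool" where
  "prime_submodule P R M \<longleftrightarrow> submodule P R M \<and> P \<noteq> carrier M \<and>
     (\<forall>r\<in>carrier R. \<forall>x\<in>carrier M. r \<odot>\<^bsub>M\<^esub> x \<in> P \<longrightarrow> r \<in> colon R M P \<or> x \<in> P)"

definition prime_submodule_over ::
    "'a set \<Rightarrow> 'b set \<Rightarrow> ('a, 'm) ring_scheme \<Rightarrow> ('a, 'b, 'n) module_scheme \<Rightarrow> bool" where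
  "prime_submodule_over p P R M \<longleftrightarrow> prime_submodule P R M \<and> p = colon R M P"

definition spec_ring :: "('a, 'm) ring_scheme \<Rightarrow> 'a set set" where
  "spec_ring R = {I. primeideal I R}"

definition qspec_ring :: "('a, 'm) ring_scheme \<Rightarrow> 'a set set" where
  "qspec_ring R = {I. quasi_prime_ideal I R}"

definition spec :: "('a, 'm) ring_scheme \<Rightarrow> ('a, 'b, 'n) module_scheme \<Rightarrow> 'b set set" where
  "spec R M = {P. prime_submodule P R M}"

definition qspec :: "('a, 'm) ring_scheme \<Rightarrow> ('a, 'b, 'n) module_scheme \<Rightarrow> 'b set set" where
  "qspec R M = {N. quasi_prime_submodule N R M}"

text \<open>The map \<open>L \<mapsto> (L : M) / Ann(M)\<close>, whose value is a set of cosets in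
  \<open>R Quot annihilator R M\<close>. It serves both \<open>qspec\<close> and \<open>spec\<close>.\<close>

definition natural_map ::
    "('a, 'm) ring_scheme \<Rightarrow> ('a, 'b, 'n) module_scheme \<Rightarrow> 'b set \<Rightarrow> 'a set set" where
  "natural_map R M L = (\<lambda>r. annihilator R M +>\<^bsub>R\<^esub> r) ` colon R M L"

definition quasi_primeful ::
    "('a, 'm) ring_scheme \<Rightarrow> ('a, 'b, 'n) module_scheme \<Rightarrow> bool" where
  "quasi_primeful R M \<longleftrightarrow> carrier M = {\<zero>\<^bsub>M\<^esub>} \<or>
     natural_map R M ` qspec R M = qspec_ring (R Quot annihilator R M)"

definition primeful ::
    "('a, 'm) ring_scheme \<Rightarrow> ('a, 'b, 'n) module_scheme \<Rightarrow> bool" where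
  "primeful R M \<longleftrightarrow> carrier M = {\<zero>\<^bsub>M\<^esub>} \<or>
     natural_map R M ` spec R M = spec_ring (R Quot annihilator R M)"

end

theory Submission
  imports Defs "HOL-Algebra.Ring_Divisibility"
begin

text \<open>Every prime ideal \<open>p\<close> containing \<open>Ann(M)\<close> is quasi-prime, hence \<open>p = (L : M)\<close> for some
  submodule \<open>L\<close>; then \<open>pM \<subseteq> L\<close> forces \<open>(pM : M) = p\<close>. Everything else follows from this, because a
  radical ideal is an intersection of primes. In part (5), the elements \<open>r\<close> for which \<open>rM\<close> lies in a
  finitely generated submodule form an ideal; if it were contained in a prime ideal \<open>p\<close>, then
  \<open>x \<in> Rx = IM \<subseteq> pM\<close> for every \<open>x\<close>, because \<open>I \<subseteq> (Rx : M) \<subseteq> p\<close>, contradicting \<open>pM \<noteq> M\<close>.\<close>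

section \<open>Prime ideals\<close>

text \<open>Zorn yields an ideal maximal among those that contain \<open>I\<close> and miss every
  positive power of \<open>r\<close>; maximality makes it prime. This is what turns a radical ideal
  into an intersection of primes.\<close>

lemma (in cring) exists_primeideal_avoiding:
  assumes I: "ideal I R" and r: "r \<in> carrier R" "r \<notin> rad R I"
  obtains p where "primeideal p R" "I \<subseteq> p" "r \<notin> p"
proof -
  define F where "F = {J. ideal J R \<and> I \<subseteq> J \<and> (\<forall>n::nat>0. r [^] n \<notin> J)}"
  have "\<exists>J\<in>F. \<forall>X\<in>F. J \<subseteq> X \<longrightarrow> X = J"
  proof (rule subset_Zorn_nonempty)
    show "F \<noteq> {}"
      using I r unfolding F_def rad_def by blast
  next
    fix C assume C: "C \<noteq> {}" "subset.chain F C"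
    then have CF: "C \<subseteq> F"
      by (simp add: pred_on.chain_def)
    \<comment> \<open>The union of a nonempty chain of ideals is an ideal, and a power of
      \<open>r\<close> in the union would already lie in some member of the chain.\<close>
    have "subset.chain {J. ideal J R} C"
      using C(2) unfolding pred_on.chain_def F_def by blast
    then have "ideal (\<Union>C) R"
      using chain_Union_is_ideal[of C] C(1) by simp
    moreover have "I \<subseteq> \<Union>C"
      using C(1) CF unfolding F_def by auto
    ultimately show "\<Union>C \<in> F"
      using CF unfolding F_def by auto
  qed
  then obtain J where JF: "J \<in> F" and max: "\<And>X. X \<in> F \<Longrightarrow> J \<subseteq> X \<Longrightarrow> X = J"
    by blast
  have J: "ideal J R" "I \<subseteq> J" "\<And>n::nat. n > 0 \<Longrightarrow> r [^] n \<notin> J"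
    using JF unfolding F_def by auto
  interpret J: ideal J R by (rule J(1))
  \<comment> \<open>By maximality of \<open>J\<close>, the strictly larger ideal
    \<open>J + (a)\<close> must contain a positive power of \<open>r\<close>.\<close>
  have power_in_sum: "\<exists>n::nat>0. \<exists>j\<in>J. \<exists>c\<in>carrier R. r [^] n = j \<oplus> c \<otimes> a"
    if a: "a \<in> carrier R" "a \<notin> J" for a
  proof -
    let ?K = "set_add R J (PIdl a)"
    have K: "ideal ?K R"
      by (intro add_ideals J(1) cgenideal_ideal a(1))
    have sub: "J \<subseteq> ?K"
    proof
      fix j assume "j \<in> J"
      moreover have "\<zero> \<in> PIdl a"
        using cgenideal_ideal[OF a(1)] by (simp add: additive_subgroup.zero_closed ideal.axioms(1))
      moreover have "j = j \<oplus> \<zero>"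
        using \<open>j \<in> J\<close> J.Icarr by simp
      ultimately show "j \<in> ?K"
        unfolding set_add_def' by blast
    qed
    have "a \<in> ?K"
      unfolding set_add_def' using cgenideal_self[OF a(1)] J.zero_closed l_zero[OF a(1), symmetric]
      by blast
    then have "?K \<notin> F"
      using max[of ?K] sub a(2) by blast
    then obtain n :: nat where n: "n > 0" "r [^] n \<in> ?K"
      using K sub J(2) unfolding F_def by blast
    then show ?thesis
      unfolding set_add_def' cgenideal_def by blast
  qed
  have "primeideal J R"
  proof (rule primeidealI[OF J(1) is_cring])
    show "carrier R \<noteq> J"
      using J(3)[of 1] r(1) by auto
    fix a b assume ab: "a \<in> carrier R" "b \<in> carrier R" "a \<otimes> b \<in> J"
    show "a \<in> J \<or> b \<in> J"
    proof (rule ccontr)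
      assume "\<not> (a \<in> J \<or> b \<in> J)"
      then obtain m n :: nat and i j c d
        where m: "m > 0" "i \<in> J" "c \<in> carrier R" "r [^] m = i \<oplus> c \<otimes> a"
          and n: "n > 0" "j \<in> J" "d \<in> carrier R" "r [^] n = j \<oplus> d \<otimes> b"
        using power_in_sum[of a] power_in_sum[of b] ab by blast
      have ij: "i \<in> carrier R" "j \<in> carrier R"
        using m n J.Icarr by auto
      have "r [^] (m + n) = (i \<oplus> c \<otimes> a) \<otimes> (j \<oplus> d \<otimes> b)"
        using m(4) n(4) r(1) nat_pow_mult[of r m n] by simp
      \<comment> \<open>The expansion is grouped so that each summand has a factor in
        \<open>J\<close>, namely \<open>i\<close>, \<open>j\<close> or
        \<open>a \<otimes> b\<close>.\<close>
      also have "\<dots> = i \<otimes> (j \<oplus> d \<otimes> b) \<oplus> (c \<otimes> a) \<otimes> j \<oplus> (c \<otimes> d) \<otimes> (a \<otimes> b)"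
        using ij ab m(3) n(3) by algebra
      also have "\<dots> \<in> J"
        using ij ab m n by (simp add: J.I_l_closed J.I_r_closed)
      finally show False
        using J(3)[of "m + n"] m(1) by simp
    qed
  qed
  moreover have "r \<notin> J"
    using J(3)[of 1] r(1) by auto
  ultimately show thesis
    using that J(2) by blast
qed

text \<open>The case \<open>r = \<one>\<close> of the previous lemma: all powers of
  \<open>\<one>\<close> are \<open>\<one>\<close>, which a proper ideal does not contain.\<close>

lemma (in cring) exists_primeideal_over:
  assumes I: "ideal I R" "I \<noteq> carrier R"
  obtains p where "primeideal p R" "I \<subseteq> p"
proof -
  have "\<one> \<notin> rad R I"
    using I ideal.one_imp_carrier unfolding rad_def by auto
  then show thesis
    using exists_primeideal_avoiding[OF I(1)] that one_closed by metis
qed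

text \<open>An ideal strictly between \<open>p\<close> and the ring lies in a prime
  \<open>q\<close>, and \<open>p \<subset> q\<close> is then a chain of length one.\<close>

lemma (in cring) maximalideal_if_krull_dim_0:
  assumes dim: "krull_dim R = 0" and p: "primeideal p R"
  shows "maximalideal p R"
proof (rule maximalidealI)
  show p': "ideal p R" and "carrier R \<noteq> p"
    using p primeideal.axioms(1) primeideal.I_notcarr by auto
  fix J assume J: "ideal J R" "p \<subseteq> J"
  show "J = p \<or> J = carrier R"
  proof (rule ccontr)
    assume neq: "\<not> ?thesis"
    then obtain q where q: "primeideal q R" "J \<subseteq> q"
      using exists_primeideal_over[OF J(1)] by blast
    \<comment> \<open>A chain of length 1 uses only the indices 0 and 1; the values beyond are
      irrelevant.\<close>
    define P where "P = (\<lambda>i::nat. if i = 0 then p else q)"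
    have "(\<forall>i\<le>1. primeideal (P i) R) \<and> (\<forall>i<1. P i \<subset> P (Suc i))"
      using p q J(2) neq unfolding P_def by auto
    then have "enat 1 \<le> krull_dim R"
      unfolding krull_dim_def by (intro Sup_upper) blast
    with dim show False
      by (simp add: zero_enat_def)
  qed
qed

lemma ideal_subset_carrier: "ideal I R \<Longrightarrow> I \<subseteq> carrier R"
  by (simp add: additive_subgroup.a_subset ideal.axioms(1))

text \<open>If \<open>a \<in> A\<close> and \<open>b \<in> B\<close> both lie outside
  \<open>p\<close>, their product lies in \<open>A \<inter> B\<close> but not in
  \<open>p\<close>.\<close>

lemma quasi_prime_ideal_if_primeideal:
  assumes "primeideal p R"
  shows "quasi_prime_ideal p R"
proof -
  interpret primeideal p R by fact
  have "A \<subseteq> p \<or> B \<subseteq> p" if AB: "ideal A R" "ideal B R" "A \<inter> B \<subseteq> p" for A B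
  proof (rule ccontr)
    assume "\<not> ?thesis"
    then obtain a b where ab: "a \<in> A" "a \<notin> p" "b \<in> B" "b \<notin> p"
      by blast
    then have carr: "a \<in> carrier R" "b \<in> carrier R"
      using AB ideal.Icarr by metis+
    then have "a \<otimes>\<^bsub>R\<^esub> b \<in> A \<inter> B"
      using AB ab ideal.I_r_closed ideal.I_l_closed by (metis IntI)
    then show False
      using I_prime carr AB(3) ab by blast
  qed
  then show ?thesis
    unfolding quasi_prime_ideal_def using is_ideal I_notcarr by blast
qed

lemma (in cring) radical_ideal_if_primeideal:
  assumes "primeideal p R"
  shows "radical_ideal p R"
proof -
  interpret p: primeideal p R by fact
  have "r \<in> p" if "r \<in> carrier R" "r [^] (n::nat) \<in> p" for r n
    using that
  proof (induction n)
    \<comment> \<open>For exponent zero the premise says \<open>\<one> \<in> p\<close>, which makes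
      \<open>p\<close> the whole ring, so the conclusion still holds.\<close>
    case 0
    then show ?case
      using p.one_imp_carrier by simp
  next
    case (Suc n)
    then show ?case
      using p.I_prime[of "r [^] n" r] by auto
  qed
  then have "rad R p \<subseteq> p"
    unfolding rad_def by auto
  moreover have "p \<subseteq> rad R p"
  proof
    fix r assume "r \<in> p"
    then show "r \<in> rad R p"
      using p.Icarr unfolding rad_def by (auto intro!: exI[of _ "1::nat"])
  qed
  ultimately have "rad R p = p"
    by (rule equalityI)
  then show ?thesis
    unfolding radical_ideal_def using p.is_ideal by blast
qed

section \<open>Ideal correspondence for a quotient ring\<close>

lemma (in cring) quot_coset_image_inject:
  assumes "ideal A R" "ideal I R" "A \<subseteq> I" "ideal J R" "A \<subseteq> J" "(+>) A ` I = (+>) A ` J"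
  shows "I = J"
  using inj_onD[OF bij_betw_imp_inj_on[OF quot_ideal_correspondence[OF assms(1)]], of I J] assms
  by simp

lemma (in cring) quot_ideal_obtain:
  assumes "ideal A R" "ideal Q (R Quot A)"
  obtains J where "ideal J R" "A \<subseteq> J" "Q = (+>) A ` J"
proof -
  have "Q \<in> {Q. ideal Q (R Quot A)}"
    using assms(2) by simp
  also have "\<dots> = (\<lambda>J. (+>) A ` J) ` {J. ideal J R \<and> A \<subseteq> J}"
    by (rule bij_betw_imp_surj_on[OF quot_ideal_correspondence[OF assms(1)], symmetric])
  finally show thesis
    using that by (elim imageE CollectE conjE)
qed

text \<open>Since \<open>A \<subseteq> J\<close>, the ideal \<open>J\<close> is a union of cosets of
  \<open>A\<close>, so membership can be tested on any representative.\<close>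

lemma (in cring) quot_mem_image_iff:
  assumes "ideal A R" "ideal J R" "A \<subseteq> J" "a \<in> carrier R"
  shows "A +> a \<in> (+>) A ` J \<longleftrightarrow> a \<in> J"
proof
  assume "A +> a \<in> (+>) A ` J"
  then obtain j where j: "j \<in> J" "A +> a = A +> j" by blast
  then have jc: "j \<in> carrier R"
    using assms(2) ideal.Icarr by metis
  have "a \<ominus> j \<in> J"
    using quotient_eq_iff_same_a_r_cos[OF assms(1,4) jc] j(2) assms(3) by blast
  then have "(a \<ominus> j) \<oplus> j \<in> J"
    using j(1) assms(2) by (simp add: additive_subgroup.a_closed ideal.axioms(1))
  moreover have "(a \<ominus> j) \<oplus> j = a"
    using assms(4) jc by algebra
  ultimately show "a \<in> J" by simp
qed blast

text \<open>Products of cosets are computed on representatives, so both directions reduce to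
  membership in \<open>J\<close>.\<close>

lemma (in cring) primeideal_quot_iff:
  assumes A: "ideal A R" and J: "ideal J R" "A \<subseteq> J"
  shows "primeideal ((+>) A ` J) (R Quot A) \<longleftrightarrow> primeideal J R"
proof -
  note mem = quot_mem_image_iff[OF A J]
  have carr: "carrier (R Quot A) = (+>) A ` carrier R"
    unfolding FactRing_def A_RCOSETS_def' by auto
  have mult: "(A +> a) \<otimes>\<^bsub>R Quot A\<^esub> (A +> b) = A +> (a \<otimes> b)"
    if "a \<in> carrier R" "b \<in> carrier R" for a b
    using ideal.rcoset_mult_add[OF A that] by (simp add: FactRing_def)
  \<comment> \<open>Properness transfers by injectivity of the correspondence, applied to
    \<open>J\<close> and the unit ideal.\<close>
  have proper: "carrier (R Quot A) = (+>) A ` J \<longleftrightarrow> carrier R = J"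
    unfolding carr using quot_coset_image_inject[OF A oneideal _ J] J
      additive_subgroup.a_subset[OF ideal.axioms(1)[OF A]] by auto
  show ?thesis
  proof
    assume P: "primeideal ((+>) A ` J) (R Quot A)"
    show "primeideal J R"
    proof (rule primeidealI[OF J(1) is_cring])
      show "carrier R \<noteq> J"
        using primeideal.I_notcarr[OF P] proper by blast
      fix a b assume ab: "a \<in> carrier R" "b \<in> carrier R" "a \<otimes> b \<in> J"
      then have "(A +> a) \<otimes>\<^bsub>R Quot A\<^esub> (A +> b) \<in> (+>) A ` J"
        by (simp add: mult)
      then show "a \<in> J \<or> b \<in> J"
        using primeideal.I_prime[OF P, of "A +> a" "A +> b"] ab by (auto simp: carr mem)
    qed
  next
    assume P: "primeideal J R"
    show "primeideal ((+>) A ` J) (R Quot A)"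
    proof (rule primeidealI[OF ring_ideal_imp_quot_ideal[OF A J(1)] ideal.quotient_is_cring[OF A is_cring]])
      show "carrier (R Quot A) \<noteq> (+>) A ` J"
        using primeideal.I_notcarr[OF P] proper by blast
      fix x y
      assume xy: "x \<in> carrier (R Quot A)" "y \<in> carrier (R Quot A)"
        "x \<otimes>\<^bsub>R Quot A\<^esub> y \<in> (+>) A ` J"
      then obtain a b where "x = A +> a" "y = A +> b" "a \<in> carrier R" "b \<in> carrier R"
        unfolding carr by blast
      then show "x \<in> (+>) A ` J \<or> y \<in> (+>) A ` J"
        using xy(3) primeideal.I_prime[OF P, of a b] by (simp add: mult mem)
    qed
  qed
qed

section \<open>Colon ideals and products of ideals and modules\<close>

context Module.module
begin

lemma submodule_zero_closed: "submodule N R M \<Longrightarrow> \<zero>\<^bsub>M\<^esub> \<in> N"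
  using subgroup.one_closed[OF submodule.axioms(1), of N R M] by simp

lemma submodule_submodule_gen:
  assumes "S \<subseteq> carrier M"
  shows "submodule (submodule_gen R M S) R M"
  unfolding submodule_gen_def
proof (rule submoduleI)
  \<comment> \<open>\<open>carrier M\<close> itself belongs to the family, which keeps the
    intersection inside the module.\<close>
  show "\<Inter>{N. submodule N R M \<and> S \<subseteq> N} \<subseteq> carrier M"
    using assms carrier_is_submodule by blast
qed (simp_all add: submodule_zero_closed submoduleE)

lemma submodule_gen_superset: "S \<subseteq> submodule_gen R M S"
  unfolding submodule_gen_def by blast

lemma submodule_gen_minimal: "submodule N R M \<Longrightarrow> S \<subseteq> N \<Longrightarrow> submodule_gen R M S \<subseteq> N"
  unfolding submodule_gen_def by blast

lemma submodule_gen_mono: "S \<subseteq> T \<Longrightarrow> submodule_gen R M S \<subseteq> submodule_gen R M T"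
  unfolding submodule_gen_def by blast

lemma submodule_ideal_smult:
  assumes "I \<subseteq> carrier R"
  shows "submodule (ideal_smult R M I) R M"
  unfolding ideal_smult_def using assms by (intro submodule_submodule_gen) (auto intro: smult_closed)

lemma ideal_smultI: "a \<in> I \<Longrightarrow> x \<in> carrier M \<Longrightarrow> a \<odot>\<^bsub>M\<^esub> x \<in> ideal_smult R M I"
  unfolding ideal_smult_def by (rule subsetD[OF submodule_gen_superset]) blast

text \<open>A Galois connection: forming \<open>IM\<close> is left adjoint to forming
  \<open>(N : M)\<close>. Later comparisons of \<open>IM\<close> with other submodules go through
  it.\<close>

lemma ideal_smult_subset_iff:
  assumes "submodule N R M" "I \<subseteq> carrier R"
  shows "ideal_smult R M I \<subseteq> N \<longleftrightarrow> I \<subseteq> colon R M N"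
proof
  assume "ideal_smult R M I \<subseteq> N"
  then have "a \<odot>\<^bsub>M\<^esub> x \<in> N" if "a \<in> I" "x \<in> carrier M" for a x
    using ideal_smultI[OF that] by blast
  then show "I \<subseteq> colon R M N"
    using assms(2) unfolding colon_def by blast
next
  assume "I \<subseteq> colon R M N"
  then have "{a \<odot>\<^bsub>M\<^esub> x | a x. a \<in> I \<and> x \<in> carrier M} \<subseteq> N"
    unfolding colon_def by blast
  then show "ideal_smult R M I \<subseteq> N"
    unfolding ideal_smult_def by (rule submodule_gen_minimal[OF assms(1)])
qed

lemma colon_mono: "N \<subseteq> L \<Longrightarrow> colon R M N \<subseteq> colon R M L"
  unfolding colon_def by blast

lemma ideal_subset_colon: "I \<subseteq> carrier R \<Longrightarrow> I \<subseteq> colon R M (ideal_smult R M I)"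
  using ideal_smult_subset_iff[OF submodule_ideal_smult, of I I] by simp

lemma ideal_colon:
  assumes N: "submodule N R M"
  shows "ideal (colon R M N) R"
proof (rule idealI)
  note E = submoduleE[OF N] submodule_zero_closed[OF N]
  show "subgroup (colon R M N) (add_monoid R)"
  proof (rule R.add.subgroupI)
    show "colon R M N \<noteq> {}"
      using E(7) unfolding colon_def by force
  qed (auto simp: colon_def smult_l_distr smult_l_minus E)
  fix a x assume ax: "a \<in> colon R M N" "x \<in> carrier R"
  then show "x \<otimes> a \<in> colon R M N"
    unfolding colon_def by (auto simp: smult_assoc1 E)
  with ax show "a \<otimes> x \<in> colon R M N"
    by (simp add: m_comm colon_def)
qed (rule R.ring_axioms)

text \<open>The scalar \<open>\<one>\<close> decides the nontrivial direction.\<close>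

lemma colon_eq_carrier_iff:
  assumes N: "submodule N R M"
  shows "colon R M N = carrier R \<longleftrightarrow> N = carrier M"
proof
  assume "colon R M N = carrier R"
  then have "\<one> \<in> colon R M N"
    by simp
  then show "N = carrier M"
    using submoduleE(1)[OF N] unfolding colon_def by auto
qed (auto simp: colon_def)

text \<open>\<open>Ann(M)\<close> is the colon of the smallest submodule. This lets colon ideals
  pass to the quotient by \<open>Ann(M)\<close>, and it gives the necessity of
  \<open>Ann(M) \<subseteq> I\<close> in part (1).\<close>

lemma annihilator_subset_colon: "submodule N R M \<Longrightarrow> annihilator R M \<subseteq> colon R M N"
  unfolding annihilator_def by (simp add: colon_mono submodule_zero_closed)

lemma ideal_annihilator: "ideal (annihilator R M) R"
  unfolding annihilator_def by (intro ideal_colon submoduleI) auto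

lemma primeideal_colon:
  assumes P: "prime_submodule P R M"
  shows "primeideal (colon R M P) R"
proof (rule primeidealI)
  have sub: "submodule P R M" and ne: "P \<noteq> carrier M"
    using P unfolding prime_submodule_def by auto
  show "ideal (colon R M P) R"
    by (rule ideal_colon[OF sub])
  show "carrier R \<noteq> colon R M P"
    using colon_eq_carrier_iff[OF sub] ne by auto
  fix a b assume ab: "a \<in> carrier R" "b \<in> carrier R" "a \<otimes> b \<in> colon R M P"
  have "b \<in> colon R M P" if a: "a \<notin> colon R M P"
  proof -
    have "b \<odot>\<^bsub>M\<^esub> x \<in> P" if x: "x \<in> carrier M" for x
    proof -
      \<comment> \<open>Primeness of \<open>P\<close> is applied to the scalar \<open>a\<close> and
        the vector \<open>bx\<close>; as \<open>aM\<close> is not inside \<open>P\<close>, the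
        vector must be.\<close>
      have "a \<odot>\<^bsub>M\<^esub> (b \<odot>\<^bsub>M\<^esub> x) \<in> P"
        using ab x smult_assoc1[of a b x] unfolding colon_def by auto
      then show ?thesis
        using P a ab x unfolding prime_submodule_def by blast
    qed
    then show ?thesis
      using ab unfolding colon_def by blast
  qed
  then show "a \<in> colon R M P \<or> b \<in> colon R M P"
    by blast
qed (rule is_cring)

text \<open>This inclusion holds for every module, so primefulness reduces to surjectivity.\<close>

lemma natural_map_spec_subset: "natural_map R M ` spec R M \<subseteq> spec_ring (R Quot annihilator R M)"
proof
  fix Q assume "Q \<in> natural_map R M ` spec R M"
  then obtain P where P: "prime_submodule P R M" "Q = natural_map R M P"
    unfolding spec_def by blast
  then have "submodule P R M"
    unfolding prime_submodule_def by blast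
  then show "Q \<in> spec_ring (R Quot annihilator R M)"
    using P primeideal_colon[OF P(1)] primeideal_quot_iff[OF ideal_annihilator ideal_colon]
      annihilator_subset_colon
    unfolding spec_ring_def natural_map_def by blast
qed

text \<open>For fixed \<open>x\<close>, the scalars that send \<open>x\<close> into \<open>N\<close>
  form an ideal above \<open>(N : M)\<close>. By maximality it is \<open>(N : M)\<close>, or it
  contains \<open>\<one>\<close> and then \<open>x \<in> N\<close>.\<close>

lemma prime_submodule_if_maximal_colon:
  assumes N: "submodule N R M" and max: "maximalideal (colon R M N) R"
  shows "prime_submodule N R M"
  unfolding prime_submodule_def
proof (intro conjI ballI impI)
  show "submodule N R M" by fact
  show "N \<noteq> carrier M"
    using maximalideal.I_notcarr[OF max] colon_eq_carrier_iff[OF N] by auto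
  fix r x assume r: "r \<in> carrier R" and x: "x \<in> carrier M" and rx: "r \<odot>\<^bsub>M\<^esub> x \<in> N"
  let ?A = "{s \<in> carrier R. s \<odot>\<^bsub>M\<^esub> x \<in> N}"
  note E = submoduleE[OF N] submodule_zero_closed[OF N]
  have "ideal ?A R"
  proof (rule idealI)
    show "subgroup ?A (add_monoid R)"
    proof (rule R.add.subgroupI)
      show "?A \<noteq> {}"
        using E(7) x by force
    qed (auto simp: smult_l_distr smult_l_minus E x)
    fix a y assume ay: "a \<in> ?A" "y \<in> carrier R"
    then show "y \<otimes> a \<in> ?A"
      by (auto simp: smult_assoc1 E x)
    with ay show "a \<otimes> y \<in> ?A"
      by (simp add: m_comm)
  qed (rule R.ring_axioms)
  moreover have "colon R M N \<subseteq> ?A"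
    using x unfolding colon_def by blast
  ultimately have "?A = colon R M N \<or> ?A = carrier R"
    using maximalideal.I_maximal[OF max] by blast
  moreover have "x \<in> N" if "?A = carrier R"
  proof -
    have "\<one> \<in> ?A" by (simp only: that R.one_closed)
    with x show ?thesis by simp
  qed
  ultimately show "r \<in> colon R M N \<or> x \<in> N"
    using r rx by blast
qed

text \<open>The colon ideals involved form a directed family, since those of \<open>S\<close> and
  \<open>S'\<close> both lie in that of \<open>S \<union> S'\<close>; a directed union of ideals is
  an ideal.\<close>

lemma ideal_Union_colon_finite:
  "ideal {r. \<exists>S. finite S \<and> S \<subseteq> carrier M \<and> r \<in> colon R M (submodule_gen R M S)} R"
    (is "ideal ?T R")
proof (rule idealI)
  note gen = ideal_colon[OF submodule_submodule_gen]
  show "subgroup ?T (add_monoid R)"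
  proof (rule R.add.subgroupI)
    show "?T \<subseteq> carrier R"
      unfolding colon_def by blast
    have "\<zero> \<in> colon R M (submodule_gen R M {})"
      using gen by (simp add: additive_subgroup.zero_closed ideal.axioms(1))
    then show "?T \<noteq> {}"
      by blast
  next
    fix a assume "a \<in> ?T"
    then obtain S where S: "finite S" "S \<subseteq> carrier M" "a \<in> colon R M (submodule_gen R M S)"
      by blast
    then have "\<ominus> a \<in> colon R M (submodule_gen R M S)"
      using additive_subgroup.a_inv_closed[OF ideal.axioms(1)[OF gen[of S]]] by blast
    then show "\<ominus> a \<in> ?T"
      using S by blast
  next
    fix a b assume "a \<in> ?T" "b \<in> ?T"
    then obtain S S' where S: "finite S" "S \<subseteq> carrier M" "a \<in> colon R M (submodule_gen R M S)"
      and S': "finite S'" "S' \<subseteq> carrier M" "b \<in> colon R M (submodule_gen R M S')"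
      by blast
    have "a \<in> colon R M (submodule_gen R M (S \<union> S'))"
      using S(3) colon_mono[OF submodule_gen_mono[of S "S \<union> S'"]] by blast
    moreover have "b \<in> colon R M (submodule_gen R M (S \<union> S'))"
      using S'(3) colon_mono[OF submodule_gen_mono[of S' "S \<union> S'"]] by blast
    ultimately have "a \<oplus> b \<in> colon R M (submodule_gen R M (S \<union> S'))"
      using S S' additive_subgroup.a_closed[OF ideal.axioms(1)[OF gen[of "S \<union> S'"]]] by blast
    then show "a \<oplus> b \<in> ?T"
      using S S' by blast
  qed
  fix a x assume "a \<in> ?T" "x \<in> carrier R"
  then obtain S where S: "finite S" "S \<subseteq> carrier M"
    "x \<otimes> a \<in> colon R M (submodule_gen R M S)" "a \<otimes> x \<in> colon R M (submodule_gen R M S)"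
    using ideal.I_l_closed[OF gen] ideal.I_r_closed[OF gen] by auto
  then show "x \<otimes> a \<in> ?T" "a \<otimes> x \<in> ?T"
    by blast+
qed (rule R.ring_axioms)

lemma fin_gen_if_multiplication_module:
  assumes mult: "multiplication_module R M"
    and proper: "\<And>p. primeideal p R \<Longrightarrow> annihilator R M \<subseteq> p \<Longrightarrow> ideal_smult R M p \<noteq> carrier M"
  shows "fin_gen_module R M"
proof -
  define T where
    "T = {r. \<exists>S. finite S \<and> S \<subseteq> carrier M \<and> r \<in> colon R M (submodule_gen R M S)}"
  have T: "ideal T R"
    unfolding T_def by (rule ideal_Union_colon_finite)
  have "T = carrier R"
  proof (rule ccontr)
    assume "T \<noteq> carrier R"
    then obtain p where p: "primeideal p R" "T \<subseteq> p"
      using exists_primeideal_over[OF T] by blast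
    then have p_sub: "p \<subseteq> carrier R"
      by (intro ideal_subset_carrier primeideal.axioms(1))
    \<comment> \<open>The choice \<open>S = {}\<close> puts the annihilator inside \<open>T\<close>,
      hence inside \<open>p\<close>, so that \<open>proper\<close> applies to
      \<open>p\<close>.\<close>
    have "annihilator R M \<subseteq> colon R M (submodule_gen R M {})"
      by (intro annihilator_subset_colon submodule_submodule_gen) simp
    also have "\<dots> \<subseteq> T"
      unfolding T_def by blast
    finally have ann: "annihilator R M \<subseteq> p"
      using p(2) by blast
    have "x \<in> ideal_smult R M p" if x: "x \<in> carrier M" for x
    proof -
      have gen: "submodule (submodule_gen R M {x}) R M"
        using x by (intro submodule_submodule_gen) simp
      \<comment> \<open>The multiplication property is used for the cyclic submodule
        \<open>Rx\<close>.\<close>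
      then obtain I where I: "ideal I R" "submodule_gen R M {x} = ideal_smult R M I"
        using mult unfolding multiplication_module_def by blast
      have I_sub: "I \<subseteq> carrier R"
        by (rule ideal_subset_carrier[OF I(1)])
      have "I \<subseteq> colon R M (submodule_gen R M {x})"
        using I(2) ideal_smult_subset_iff[OF gen I_sub] by simp
      also have "\<dots> \<subseteq> T"
        unfolding T_def using x by blast
      \<comment> \<open>The chain runs from \<open>I\<close> through \<open>(Rx : M)\<close>,
        \<open>T\<close> and \<open>p\<close> to \<open>(pM : M)\<close>; the adjunction turns it
        into \<open>IM \<subseteq> pM\<close>.\<close>
      finally have "I \<subseteq> colon R M (ideal_smult R M p)"
        using p(2) ideal_subset_colon[OF p_sub] by blast
      then have "ideal_smult R M I \<subseteq> ideal_smult R M p"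
        using ideal_smult_subset_iff[OF submodule_ideal_smult[OF p_sub] I_sub] by blast
      then show ?thesis
        using I(2) submodule_gen_superset[of "{x}"] by blast
    qed
    then have "ideal_smult R M p = carrier M"
      using submoduleE(1)[OF submodule_ideal_smult[OF p_sub]] by blast
    with proper[OF p(1) ann] show False
      by blast
  qed
  then have "\<one> \<in> T"
    by simp
  \<comment> \<open>Membership of \<open>\<one>\<close> in \<open>T\<close> means that one finite
    set already generates all of \<open>M\<close>.\<close>
  then obtain S where S: "finite S" "S \<subseteq> carrier M" "\<one> \<in> colon R M (submodule_gen R M S)"
    unfolding T_def by blast
  have gen: "submodule (submodule_gen R M S) R M"
    using S(2) by (rule submodule_submodule_gen)
  have "submodule_gen R M S = carrier M"
    using ideal.one_imp_carrier[OF ideal_colon[OF gen] S(3)] colon_eq_carrier_iff[OF gen] by blast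
  then show ?thesis
    using S unfolding fin_gen_module_def by blast
qed

section \<open>Quasi-primeful modules\<close>

lemma quasi_primeful_prime_eq_colon:
  assumes qp: "quasi_primeful R M" and nz: "carrier M \<noteq> {\<zero>\<^bsub>M\<^esub>}"
    and p: "primeideal p R" "annihilator R M \<subseteq> p"
  obtains L where "submodule L R M" "colon R M L = p"
proof -
  let ?A = "annihilator R M"
  have pi: "ideal p R"
    using p(1) primeideal.axioms(1) by blast
  have "primeideal ((+>) ?A ` p) (R Quot ?A)"
    using primeideal_quot_iff[OF ideal_annihilator pi p(2)] p(1) by simp
  \<comment> \<open>The quotient of \<open>p\<close> is prime, hence quasi-prime, so it lies in the
    range of the natural map.\<close>
  then have "(+>) ?A ` p \<in> qspec_ring (R Quot ?A)"
    by (simp add: qspec_ring_def quasi_prime_ideal_if_primeideal)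
  also have "\<dots> = natural_map R M ` qspec R M"
    using qp nz by (simp add: quasi_primeful_def)
  finally obtain L where "L \<in> qspec R M" "(+>) ?A ` p = natural_map R M L"
    by (rule imageE)
  then have L: "submodule L R M" "(+>) ?A ` p = (+>) ?A ` colon R M L"
    by (simp_all add: natural_map_def qspec_def quasi_prime_submodule_def)
  \<comment> \<open>Both ideals contain the annihilator, so equality of their images lifts to
    equality in \<open>R\<close>.\<close>
  have "colon R M L = p"
    using quot_coset_image_inject[OF ideal_annihilator ideal_colon[OF L(1)]
        annihilator_subset_colon[OF L(1)] pi p(2)] L(2) by simp
  with L(1) show thesis
    by (rule that)
qed

lemma quasi_primeful_colon_ideal_smult_radical:
  assumes qp: "quasi_primeful R M" and nz: "carrier M \<noteq> {\<zero>\<^bsub>M\<^esub>}"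
    and I: "radical_ideal I R" "annihilator R M \<subseteq> I"
  shows "colon R M (ideal_smult R M I) = I"
proof
  have Ii: "ideal I R" and rad: "rad R I = I"
    using I(1) unfolding radical_ideal_def by auto
  have I_sub: "I \<subseteq> carrier R"
    by (rule ideal_subset_carrier[OF Ii])
  show "I \<subseteq> colon R M (ideal_smult R M I)"
    by (rule ideal_subset_colon[OF I_sub])
  show "colon R M (ideal_smult R M I) \<subseteq> I"
  proof
    fix r assume r: "r \<in> colon R M (ideal_smult R M I)"
    show "r \<in> I"
    proof (rule ccontr)
      assume "r \<notin> I"
      then obtain p where p: "primeideal p R" "I \<subseteq> p" "r \<notin> p"
        using exists_primeideal_avoiding[OF Ii, of r] r rad unfolding colon_def by blast
      then obtain L where L: "submodule L R M" "colon R M L = p"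
        using quasi_primeful_prime_eq_colon[OF qp nz p(1)] I(2) by blast
      \<comment> \<open>As \<open>I \<subseteq> p = (L : M)\<close>, the adjunction gives
        \<open>IM \<subseteq> L\<close>; then
        \<open>r \<in> (IM : M) \<subseteq> (L : M) = p\<close>, against the choice of
        \<open>p\<close>.\<close>
      have "ideal_smult R M I \<subseteq> L"
        using ideal_smult_subset_iff[OF L(1) I_sub] L(2) p(2) by blast
      then show False
        using colon_mono r L(2) p(3) by blast
    qed
  qed
qed

end

theorem proposition2p16:
  fixes R :: "('a, 'm) ring_scheme" and M :: "('a, 'b, 'n) module_scheme"
  assumes "Module.module R M"
    and "\<one>\<^bsub>R\<^esub> \<noteq> \<zero>\<^bsub>R\<^esub>"
    and "carrier M \<noteq> {\<zero>\<^bsub>M\<^esub>}"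
    and "quasi_primeful R M"
  shows "(\<forall>I. radical_ideal I R \<longrightarrow>
            (colon R M (ideal_smult R M I) = I \<longleftrightarrow> annihilator R M \<subseteq> I))
       \<and> (\<forall>p. primeideal p R \<longrightarrow> annihilator R M \<subseteq> p \<longrightarrow>
            ideal_smult R M p \<in> qspec R M)
       \<and> (\<forall>p. maximalideal p R \<longrightarrow> annihilator R M \<subseteq> p \<longrightarrow>
            prime_submodule_over p (ideal_smult R M p) R M)
       \<and> (krull_dim R = 0 \<longrightarrow> primeful R M)
       \<and> (multiplication_module R M \<longrightarrow> fin_gen_module R M)"
proof -
  interpret Module.module R M by fact
  note qp = assms(4) and nz = assms(3)
  have colon_p: "colon R M (ideal_smult R M p) = p"
    if "primeideal p R" "annihilator R M \<subseteq> p" for p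
    using quasi_primeful_colon_ideal_smult_radical[OF qp nz] radical_ideal_if_primeideal that by blast
  have sub: "submodule (ideal_smult R M I) R M" if "ideal I R" for I
    by (intro submodule_ideal_smult ideal_subset_carrier that)
  have 1: "colon R M (ideal_smult R M I) = I \<longleftrightarrow> annihilator R M \<subseteq> I" if I: "radical_ideal I R" for I
  proof
    have "ideal I R"
      using I unfolding radical_ideal_def by blast
    then show "annihilator R M \<subseteq> I" if "colon R M (ideal_smult R M I) = I"
      using annihilator_subset_colon[OF sub] that by blast
  qed (rule quasi_primeful_colon_ideal_smult_radical[OF qp nz I])
  \<comment> \<open>If \<open>pM\<close> were all of \<open>M\<close>, its colon \<open>p\<close>
    would be all of \<open>R\<close>.\<close>
  have proper: "ideal_smult R M p \<noteq> carrier M"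
    if p: "primeideal p R" "annihilator R M \<subseteq> p" for p
    using colon_p[OF p] colon_eq_carrier_iff[OF sub[OF primeideal.axioms(1)[OF p(1)]]]
      primeideal.I_notcarr[OF p(1)] by auto
  have 2: "ideal_smult R M p \<in> qspec R M" if p: "primeideal p R" "annihilator R M \<subseteq> p" for p
    unfolding qspec_def quasi_prime_submodule_def
    using proper[OF p] colon_p[OF p] sub[OF primeideal.axioms(1)[OF p(1)]]
      quasi_prime_ideal_if_primeideal[OF p(1)] by simp
  have 3: "prime_submodule_over p (ideal_smult R M p) R M"
    if p: "maximalideal p R" "annihilator R M \<subseteq> p" for p
    unfolding prime_submodule_over_def
    using colon_p[OF maximalideal_prime[OF p(1)] p(2)] p(1)
      prime_submodule_if_maximal_colon[OF sub[OF maximalideal.axioms(1)[OF p(1)]]] by simp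
  have 4: "primeful R M" if dim: "krull_dim R = 0"
  proof -
    let ?A = "annihilator R M"
    have "Q \<in> natural_map R M ` spec R M" if Q: "primeideal Q (R Quot ?A)" for Q
    proof -
      \<comment> \<open>\<open>Q\<close> is lifted to a prime \<open>p\<close> above the
        annihilator. In dimension zero \<open>p\<close> is maximal, so \<open>pM\<close> is a prime
        submodule with colon \<open>p\<close>, and it is the preimage sought.\<close>
      obtain p where p: "ideal p R" "?A \<subseteq> p" "Q = (+>\<^bsub>R\<^esub>) ?A ` p"
        using quot_ideal_obtain[OF ideal_annihilator primeideal.axioms(1)[OF Q]] by blast
      then have "primeideal p R"
        using primeideal_quot_iff[OF ideal_annihilator p(1,2)] Q by blast
      then have "prime_submodule_over p (ideal_smult R M p) R M"
        using 3 maximalideal_if_krull_dim_0[OF dim] p(2) by blast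
      then have "ideal_smult R M p \<in> spec R M" "Q = natural_map R M (ideal_smult R M p)"
        using p(3) unfolding prime_submodule_over_def spec_def natural_map_def by auto
      then show ?thesis
        by blast
    qed
    then show ?thesis
      using natural_map_spec_subset unfolding primeful_def spec_ring_def by blast
  qed
  show ?thesis
  proof (intro conjI allI impI)
    show "fin_gen_module R M" if "multiplication_module R M"
      using that proper by (rule fin_gen_if_multiplication_module)
  qed (rule 1 2 3 4; assumption)+
qed

end
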